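(* Let $d\in\mathbb{N}$ and $\mathbf{s}=(s_1,\dots,s_d)\in\mathbb{N}^d$. If $d$ is even, then $$T_\ast^{\mathcal S}(\overleftarrow{\mathbf{s}})=(-1)^{|\mathbf{s}|}T_\ast^{\mathcal S}(\mathbf{s})\quad\text{and}\quad S_\ast^{\mathcal S}(\overleftarrow{\mathbf{s}})=(-1)^{|\mathbf{s}|}S_\ast^{\mathcal S}(\mathbf{s}).$$ If $d$ is odd, then $$T_\ast^{\mathcal S}(\overleftarrow{\mathbf{s}})=(-1)^{|\mathbf{s}|}S_\ast^{\mathcal S}(\mathbf{s})\quad\text{and}\quad S_\ast^{\mathcal S}(\overleftarrow{\mathbf{s}})=(-1)^{|\mathbf{s}|}T_\ast^{\mathcal S}(\mathbf{s}).$$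
   Context: $\mathbb{N}$ is the set of positive integers; $|\mathbf{s}|=s_1+\cdots+s_d$ and $\overleftarrow{\mathbf{s}}=(s_d,\dots,s_1)$. Stuffle-regularized Euler sums: for $\mathbf{s}\in\mathbb{N}^d$, $\boldsymbol\sigma\in\{\pm1\}^d$, the partial sum $\sum_{n>n_1>\cdots>n_d>0}\prod_{j=1}^d \sigma_j^{n_j}/n_j^{s_j}$ equals $P_{\mathbf{s},\boldsymbol\sigma}(\log n+\gamma)+o(1)$ as $n\to\infty$ for a unique real polynomial $P_{\mathbf{s},\boldsymbol\sigma}$ ($\gamma$ is Euler's constant); put $\zeta_\ast(\mathbf{s};\boldsymbol\sigma)=P_{\mathbf{s},\boldsymbol\sigma}(0)$. (This is the convergent Euler sum when $(s_1,\sigma_1)\ne(1,1)$.) Regularized multiple $T$- and $S$-values: for $\mathbf{s}\in\mathbb{N}^d$, $$T_\ast(\mathbf{s})=\frac1{2^d}\sum_{\sigma_1,\dots,\sigma_d=\pm1}\Big(\prod_{1\le j\le d,\ 2\mid d-j}\sigma_j\Big)\zeta_\ast(\mathbf{s};\boldsymbol\sigma),\qquad S_\ast(\mathbf{s})=\frac1{2^d}\sum_{\sigma_1,\dots,\sigma_d=\pm1}\Big(\prod_{1\le j\le d,\ 2\nmid d-j}\sigma_j\Big)\zeta_\ast(\mathbf{s};\boldsymbol\sigma),$$ with $T_\ast(\emptyset)=S_\ast(\emptyset)=1$. Symmetric values: let $F\in\{T,S\}$ and let $\widetilde F$ be the other one ($\widetilde T=S$, $\widetilde S=T$). For $\mathbf{s}\in\mathbb{N}^d$,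 $$F_\ast^{\mathcal S}(\mathbf{s})=\sum_{i=0}^d(-1)^{s_1+\cdots+s_i}F_\ast(s_i,\dots,s_1)F_\ast(s_{i+1},\dots,s_d)\quad\text{if } d\text{ is even},$$ $$F_\ast^{\mathcal S}(\mathbf{s})=\sum_{i=0}^d(-1)^{s_1+\cdots+s_i}\widetilde F_\ast(s_i,\dots,s_1)F_\ast(s_{i+1},\dots,s_d)\quad\text{if } d\text{ is odd}.$$ *)

theory Defs
  imports "HOL-Analysis.Analysis" "HOL-Computational_Algebra.Polynomial"
begin

(* Entry s_j of a tuple (s_1,...,s_d) is s ! (j - 1); products below run over
   the 1-based index j. *)

definition euler_partial_sum :: "nat list \<Rightarrow> real list \<Rightarrow> nat \<Rightarrow> real" where
  "euler_partial_sum s \<sigma> n =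
     (\<Sum>ns\<in>{ns. length ns = length s \<and> sorted_wrt (>) ns \<and> set ns \<subseteq> {0<..<n}}.
        \<Prod>j=1..length s. (\<sigma> ! (j - 1)) ^ (ns ! (j - 1)) / real (ns ! (j - 1)) ^ (s ! (j - 1)))"

definition is_reg_poly :: "nat list \<Rightarrow> real list \<Rightarrow> real poly \<Rightarrow> bool" where
  "is_reg_poly s \<sigma> P \<longleftrightarrow>
     (\<lambda>n. euler_partial_sum s \<sigma> n - poly P (ln (real n) + euler_mascheroni)) \<longlonglongrightarrow> 0"

lemma is_reg_poly_unique:
  assumes "is_reg_poly s \<sigma> P" "is_reg_poly s \<sigma> Q"
  shows "P = Q"
proof (rule ccontr)
  assume "P \<noteq> Q"
  define L :: "nat \<Rightarrow> real" where "L n = ln (real n) + euler_mascheroni" for n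
  have "filterlim (\<lambda>n. euler_mascheroni + ln (real n)) at_top sequentially"
    by (intro filterlim_tendsto_add_at_top[OF tendsto_const]
          filterlim_compose[OF ln_at_top filterlim_real_sequentially])
  then have L: "filterlim L at_top sequentially"
    unfolding L_def by (simp add: add.commute)
  have lim: "(\<lambda>n. poly (P - Q) (L n)) \<longlonglongrightarrow> 0"
    using tendsto_diff[OF assms(2)[unfolded is_reg_poly_def] assms(1)[unfolded is_reg_poly_def]]
    by (simp add: L_def algebra_simps)
  show False
  proof (cases "degree (P - Q) = 0")
    case True
    then obtain c where c: "P - Q = [:c:]" by (metis degree_eq_zeroE)
    with lim have "c = 0" by (simp add: LIMSEQ_const_iff)
    with c \<open>P \<noteq> Q\<close> show False by simp
  next
    case False
    have "filterlim (poly (P - Q)) at_infinity at_infinity"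
      using False by (intro filterlim_poly_at_infinity) auto
    then have "filterlim (\<lambda>n. poly (P - Q) (L n)) at_infinity sequentially"
      by (rule filterlim_compose[OF _ filterlim_at_top_imp_at_infinity[OF L]])
    with lim show False
      using not_tendsto_and_filterlim_at_infinity by (metis sequentially_bot)
  qed
qed

definition reg_poly :: "nat list \<Rightarrow> real list \<Rightarrow> real poly" where
  "reg_poly s \<sigma> = (THE P. is_reg_poly s \<sigma> P)"

definition zeta_reg :: "nat list \<Rightarrow> real list \<Rightarrow> real" where
  "zeta_reg s \<sigma> = poly (reg_poly s \<sigma>) 0"

definition sign_tuples :: "nat \<Rightarrow> real list set" where
  "sign_tuples d = {\<sigma>. length \<sigma> = d \<and> set \<sigma> \<subseteq> {1, -1}}"

definition T_reg :: "nat list \<Rightarrow> real" where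
  "T_reg s = (if s = [] then 1 else
     1 / 2 ^ length s *
       (\<Sum>\<sigma>\<in>sign_tuples (length s).
          (\<Prod>j\<in>{j. 1 \<le> j \<and> j \<le> length s \<and> even (length s - j)}. \<sigma> ! (j - 1)) * zeta_reg s \<sigma>))"

definition S_reg :: "nat list \<Rightarrow> real" where
  "S_reg s = (if s = [] then 1 else
     1 / 2 ^ length s *
       (\<Sum>\<sigma>\<in>sign_tuples (length s).
          (\<Prod>j\<in>{j. 1 \<le> j \<and> j \<le> length s \<and> odd (length s - j)}. \<sigma> ! (j - 1)) * zeta_reg s \<sigma>))"

definition symmetrize :: "(nat list \<Rightarrow> real) \<Rightarrow> (nat list \<Rightarrow> real) \<Rightarrow> nat list \<Rightarrow> real" where
  "symmetrize F F' s =
     (if even (length s)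
      then \<Sum>i=0..length s. (- 1) ^ sum_list (take i s) * F (rev (take i s)) * F (drop i s)
      else \<Sum>i=0..length s. (- 1) ^ sum_list (take i s) * F' (rev (take i s)) * F (drop i s))"

definition T_sym :: "nat list \<Rightarrow> real" where
  "T_sym = symmetrize T_reg S_reg"

definition S_sym :: "nat list \<Rightarrow> real" where
  "S_sym = symmetrize S_reg T_reg"

end

theory Submission imports Defs begin

text \<open>The identity is formal in the two functions being symmetrized. Reading the sum for
  \<open>rev s\<close> from its other end swaps the two factors of each summand and turns the sign
  of a prefix of \<open>s\<close> into that of the complementary suffix; these signs differ by the
  factor \<open>(- 1) ^ sum_list s\<close> (\<open>sum_split_rev\<close>).\<close>

lemma minus_one_power_sum_list_drop:
  "(- 1 :: 'a::comm_ring_1) ^ sum_list (drop k s) =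
     (- 1) ^ sum_list s * (- 1) ^ sum_list (take k s)"
proof -
  have "(- 1 :: 'a) ^ sum_list s = (- 1) ^ sum_list (take k s) * (- 1) ^ sum_list (drop k s)"
    by (metis append_take_drop_id power_add sum_list_append)
  then show ?thesis
    \<comment> \<open>A power of -1 is its own inverse, so the prefix sign can change sides.\<close>
    by (simp add: mult.commute mult.left_commute)
qed

(* Reversing s turns the i-th summand into the (length s - i)-th one with its two F-factors
   exchanged, which in odd length exchanges the roles of F and F'. *)
lemma sum_split_rev:
  "(\<Sum>i=0..length s. (- 1) ^ sum_list (take i (rev s)) * F (rev (take i (rev s))) * G (drop i (rev s))) =
   (- 1) ^ sum_list s *
     (\<Sum>i=0..length s. (- 1) ^ sum_list (take i s) * G (rev (take i s)) * (F (drop i s) :: 'a::comm_ring_1))"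
  (is "(\<Sum>i=0..length s. ?f i) = _")
proof -
  have "(\<Sum>i=0..length s. ?f i) = (\<Sum>i=0..length s. ?f (length s - i))"
    using sum.atLeastAtMost_rev[of ?f 0 "length s"] by simp
  also have "\<dots> = (\<Sum>i=0..length s. (- 1) ^ sum_list s *
      ((- 1) ^ sum_list (take i s) * G (rev (take i s)) * F (drop i s)))"
    \<comment> \<open>Cutting \<open>rev s\<close> at \<open>length s - i\<close> yields the pieces
      \<open>rev (drop i s)\<close> and \<open>rev (take i s)\<close>.\<close>
    by (rule sum.cong) (simp_all add: take_rev drop_rev minus_one_power_sum_list_drop mult_ac)
  finally show ?thesis
    by (simp add: sum_distrib_left)
qed

text \<open>In odd length the swap puts \<open>F\<close> on the reversed prefix and
  \<open>F'\<close> on the suffix, as in \<open>symmetrize F' F\<close>; in even length both factors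
  carry \<open>F\<close>.\<close>

lemma symmetrize_rev:
  "symmetrize F F' (rev s) =
     (- 1) ^ sum_list s * (if even (length s) then symmetrize F F' s else symmetrize F' F s)"
  by (simp add: symmetrize_def sum_split_rev)

theorem proposition2p7:
  fixes d :: nat and s :: "nat list"
  assumes "d \<ge> 1" and "length s = d" and "\<forall>k\<in>set s. k \<ge> 1"
  shows "(even d \<longrightarrow>
            T_sym (rev s) = (- 1) ^ sum_list s * T_sym s \<and>
            S_sym (rev s) = (- 1) ^ sum_list s * S_sym s) \<and>
         (odd d \<longrightarrow>
            T_sym (rev s) = (- 1) ^ sum_list s * S_sym s \<and>
            S_sym (rev s) = (- 1) ^ sum_list s * T_sym s)"
  using assms by (simp add: T_sym_def S_sym_def symmetrize_rev)

end
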